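(* Let $f\in\mathcal{S}^{*}_{e}$ with $f(z)=z+a_2z^2+a_3z^3+\cdots$. Then $$|a_6|\le \frac{587}{1800}\approx 0.326111\qquad\text{and}\qquad |a_7|\le \frac{1397}{4320}\approx 0.32338.$$
   Context: Let $\mathbb{D}=\{z\in\mathbb{C}:|z|<1\}$ and let $\mathcal{A}$ be the set of analytic functions $f$ on $\mathbb{D}$ of the form $f(z)=z+a_2z^2+a_3z^3+\cdots$. For functions $h_1,h_2$ analytic on $\mathbb{D}$, $h_1\prec h_2$ ($h_1$ is subordinate to $h_2$) means that there is a Schwarz function $w$, i.e. an analytic $w$ on $\mathbb{D}$ with $w(0)=0$ and $|w(z)|\le|z|$, such that $h_1(z)=h_2(w(z))$ on $\mathbb{D}$. The class $\mathcal{S}^{*}_{e}$ is $$\mathcal{S}^{*}_{e}=\left\{f\in\mathcal{A}:\frac{zf'(z)}{f(z)}\prec e^{z}\right\}.$$ *)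

theory Defs
  imports "HOL-Complex_Analysis.Complex_Analysis"
begin

abbreviation unit_disc :: "complex set" where
  "unit_disc \<equiv> ball 0 1"

text \<open>The expansion \<open>f(z) = z + a\<^sub>2 z\<^sup>2 + a\<^sub>3 z\<^sup>3 + \<dots>\<close>; the values \<open>a 0\<close> and \<open>a 1\<close> are irrelevant.\<close>

definition normalized_expansion :: "(complex \<Rightarrow> complex) \<Rightarrow> (nat \<Rightarrow> complex) \<Rightarrow> bool" where
  "normalized_expansion f a \<longleftrightarrow>
     (\<forall>z\<in>unit_disc. (\<lambda>n. a (n + 2) * z ^ (n + 2)) sums (f z - z))"

definition class_A :: "(complex \<Rightarrow> complex) set" where
  "class_A = {f. f holomorphic_on unit_disc \<and> (\<exists>a. normalized_expansion f a)}"

definition schwarz_function :: "(complex \<Rightarrow> complex) \<Rightarrow> bool" where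
  "schwarz_function w \<longleftrightarrow>
     w holomorphic_on unit_disc \<and> w 0 = 0 \<and> (\<forall>z\<in>unit_disc. norm (w z) \<le> norm z)"

definition subordinate :: "(complex \<Rightarrow> complex) \<Rightarrow> (complex \<Rightarrow> complex) \<Rightarrow> bool" where
  "subordinate h1 h2 \<longleftrightarrow>
     h1 holomorphic_on unit_disc \<and> h2 holomorphic_on unit_disc \<and>
     (\<exists>w. schwarz_function w \<and> (\<forall>z\<in>unit_disc. h1 z = h2 (w z)))"

text \<open>
  The function \<open>z f'(z) / f(z)\<close>. For \<open>f\<close> in \<^const>\<open>class_A\<close> it has a removable singularity
  at the origin with value 1, which has to be filled in because HOL sets \<open>0 / 0 = 0\<close>.
\<close>

definition log_deriv_quotient :: "(complex \<Rightarrow> complex) \<Rightarrow> complex \<Rightarrow> complex" where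
  "log_deriv_quotient f z = (if z = 0 then 1 else z * deriv f z / f z)"

text \<open>
  The quotient must be defined on the whole disc, so \<open>f\<close> has no zero there except the origin.
  This needs no separate clause: at any other zero of \<open>f\<close> the HOL quotient would be 0,
  a value that \<^const>\<open>exp\<close> does not take.
\<close>

definition starlike_exp :: "(complex \<Rightarrow> complex) set" where
  "starlike_exp = {f \<in> class_A. subordinate (log_deriv_quotient f) exp}"

end

theory Submission
  imports Defs
begin

text \<open>
  Write \<open>z f'(z) / f(z) = exp (w z)\<close> with a Schwarz function \<open>w\<close>. Bounding \<open>a\<^sub>6\<close> and \<open>a\<^sub>7\<close> as
  polynomials in the coefficients of \<open>w\<close> is wasteful, because all their coefficients there are
  positive. The Cayley transform \<open>(1 + w) / (1 - w) = 1 + 2 T\<close> with \<open>T = w / (1 - w) = \<Sum> t\<^sub>n z\<^sup>n\<close> has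
  nonnegative real part, and in terms of the \<open>t\<^sub>n\<close> the same polynomials have mostly smaller
  coefficients, of both signs (\<open>starlike_exp_recursion_solution\<close>).

  The mixed signs can be exploited because of the inequality of Livingston type
  \<open>\<bar>t\<^sub>k\<^sub>+\<^sub>m - l t\<^sub>k t\<^sub>m\<bar> \<le> 1\<close> for \<open>0 \<le> l \<le> 2\<close> (\<open>caratheodory_coeff_diff_le_one\<close>): a monomial with a
  factor \<open>t\<^sub>k t\<^sub>m\<close> costs nothing if it can be combined with one of opposite sign and at least half its
  size that has \<open>t\<^sub>k\<^sub>+\<^sub>m\<close> in its place. The inequality itself holds because the \<open>t\<^sub>n\<close> are limits of
  trigonometric moments of the probability densities \<open>Re (1 + 2 T)\<close> on circles. A suitable grouping
  of the monomials (\<open>livingston_polynomial_bounds\<close>) followed by the triangle inequality gives the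
  two bounds.
\<close>

section \<open>Coefficients of functions with nonnegative real part\<close>

text \<open>
  With \<open>e\<close> the unimodular function \<open>cis (- 2 \<pi> x)\<close>, the left-hand side is the \<open>u\<close>-mean of
  \<open>e\<^sup>k (e\<^sup>m - l s\<^sub>m)\<close>, hence at most the \<open>u\<close>-mean of \<open>\<bar>e\<^sup>m - l s\<^sub>m\<bar> \<le> (1 + \<bar>e\<^sup>m - l s\<^sub>m\<bar>\<^sup>2) / 2\<close>.
  The mean of the square is \<open>1 - l (2 - l) \<bar>s\<^sub>m\<bar>\<^sup>2\<close>; this is where the range of \<open>l\<close> comes from.
\<close>

lemma norm_moment_diff_le_one:
  fixes u :: "real \<Rightarrow> real" and s :: "nat \<Rightarrow> complex" and l :: real
  assumes nonneg: "\<And>x. x \<in> {0..1} \<Longrightarrow> u x \<ge> 0"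
    and moment: "\<And>n. ((\<lambda>x. of_real (u x) * cis (- (2 * pi * x)) ^ n) has_integral s n) {0..1}"
    and total: "s 0 = 1" and l: "0 \<le> l" "l \<le> 2"
  shows "norm (s (k + m) - of_real l * s k * s m) \<le> 1"
proof -
  define e where "e = (\<lambda>x::real. cis (- (2 * pi * x)))"
  have norm_e: "norm (e x ^ n) = 1" for x n by (simp add: e_def norm_power)
  have moment': "((\<lambda>x. of_real (u x) * e x ^ n) has_integral s n) {0..1}" for n
    using moment[of n] by (simp add: e_def)
  define c where "c = of_real l * s m"
  have lhs: "((\<lambda>x. of_real (u x) * e x ^ (k + m) - c * (of_real (u x) * e x ^ k)) has_integral
      s (k + m) - c * s k) {0..1}"
    by (intro has_integral_diff has_integral_mult_right moment')
  have u_int: "(u has_integral 1) {0..1}"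
    using has_integral_linear[OF moment'[of 0] bounded_linear_Re] total by (simp add: o_def)
  have um: "((\<lambda>x. Re (cnj c * (of_real (u x) * e x ^ m))) has_integral Re (cnj c * s m)) {0..1}"
    using has_integral_linear[OF has_integral_mult_right[OF moment'[of m], of "cnj c"] bounded_linear_Re]
    by (simp add: o_def)
  have rhs: "((\<lambda>x. (1 + (norm c)\<^sup>2 / 2) * u x - Re (cnj c * (of_real (u x) * e x ^ m)))
      has_integral (1 + (norm c)\<^sup>2 / 2) * 1 - Re (cnj c * s m)) {0..1}"
    by (intro has_integral_diff has_integral_mult_right u_int um)
  have pointwise: "norm (of_real (u x) * e x ^ (k + m) - c * (of_real (u x) * e x ^ k))
      \<le> (1 + (norm c)\<^sup>2 / 2) * u x - Re (cnj c * (of_real (u x) * e x ^ m))"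
    if x: "x \<in> {0..1}" for x
  proof -
    define d where "d = e x ^ m - c"
    have "of_real (u x) * e x ^ (k + m) - c * (of_real (u x) * e x ^ k)
        = of_real (u x) * e x ^ k * d"
      by (simp add: d_def power_add algebra_simps)
    hence "norm (of_real (u x) * e x ^ (k + m) - c * (of_real (u x) * e x ^ k)) = u x * norm d"
      using nonneg[OF x] norm_e by (simp add: norm_mult)
    also have "\<dots> \<le> u x * ((1 + (norm d)\<^sup>2) / 2)"
      using nonneg[OF x] sum_squares_bound[of "norm d" 1]
      by (intro mult_left_mono) (auto simp: power2_eq_square)
    also have "(norm d)\<^sup>2 = 1 + (norm c)\<^sup>2 - 2 * Re (cnj c * e x ^ m)"
    proof -
      have "(Re (e x ^ m))\<^sup>2 + (Im (e x ^ m))\<^sup>2 = 1"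
        using norm_e[of x m] by (metis cmod_power2 power_one)
      thus ?thesis unfolding d_def cmod_power2
        by (simp add: power2_eq_square algebra_simps)
    qed
    finally show ?thesis by (simp add: algebra_simps)
  qed
  have "norm (s (k + m) - c * s k) \<le> (1 + (norm c)\<^sup>2 / 2) * 1 - Re (cnj c * s m)"
    using integral_norm_bound_integral[OF has_integral_integrable[OF lhs] has_integral_integrable[OF rhs] pointwise]
    unfolding integral_unique[OF lhs] integral_unique[OF rhs] .
  also have "(norm c)\<^sup>2 = l\<^sup>2 * (norm (s m))\<^sup>2"
    by (simp add: c_def norm_mult power_mult_distrib)
  also have "Re (cnj c * s m) = l * (norm (s m))\<^sup>2"
    unfolding cmod_power2 by (simp add: c_def power2_eq_square algebra_simps)
  also have "(1 + l\<^sup>2 * (norm (s m))\<^sup>2 / 2) * 1 - l * (norm (s m))\<^sup>2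
      = 1 - l * (2 - l) * (norm (s m))\<^sup>2 / 2"
    by (simp add: power2_eq_square field_simps)
  also have "\<dots> \<le> 1" using l by simp
  finally show ?thesis by (simp add: c_def mult_ac)
qed

text \<open>
  Cauchy's formula for derivatives, read as a formula for the Fourier coefficients of the
  restriction of \<open>f\<close> to a circle.
\<close>

lemma has_integral_circle_fourier:
  assumes hol: "f holomorphic_on ball 0 1" and r: "0 < r" "r < 1"
  shows "((\<lambda>x. f (of_real r * cis (2 * pi * x)) * cis (- (2 * pi * x)) ^ n) has_integral
           of_real r ^ n * ((deriv ^^ n) f 0 / fact n)) {0..1}"
proof -
  define z where "z = (\<lambda>x::real. of_real r * cis (2 * pi * x))"
  define D where "D = (deriv ^^ n) f 0 / fact n"
  have z_nz: "z x \<noteq> 0" for x using r by (simp add: z_def)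
  have hol': "f holomorphic_on cball 0 r"
    using r by (intro holomorphic_on_subset[OF hol]) auto
  have path: "circlepath 0 r x = z x" for x
    by (simp add: circlepath z_def cis_conv_exp mult_ac)
  have "((\<lambda>u. f u / u ^ Suc n) has_contour_integral (2 * pi * \<i>) * D) (circlepath 0 r)"
    using Cauchy_has_contour_integral_higher_derivative_circlepath[of 0 r f 0 n]
      r holomorphic_on_imp_continuous_on[OF hol'] holomorphic_on_subset[OF hol' ball_subset_cball]
    by (simp add: D_def)
  hence "((\<lambda>x. f (z x) / z x ^ Suc n * (2 * pi * \<i> * z x)) has_integral (2 * pi * \<i>) * D) {0..1}"
    unfolding has_contour_integral_def
    by (rule has_integral_eq[rotated])
       (simp add: path vector_derivative_circlepath01, simp add: z_def cis_conv_exp mult_ac)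
  from has_integral_mult_right[OF this, of "of_real r ^ n / (2 * pi * \<i>)"]
  have "((\<lambda>x. of_real r ^ n / (2 * pi * \<i>) * (f (z x) / z x ^ Suc n * (2 * pi * \<i> * z x)))
      has_integral of_real r ^ n * D) {0..1}"
    by (rule has_integral_eq_rhs) (simp add: field_simps)
  moreover have "of_real r ^ n / (2 * pi * \<i>) * (f (z x) / z x ^ Suc n * (2 * pi * \<i> * z x))
      = f (z x) * cis (- (2 * pi * x)) ^ n" for x
  proof -
    have "cis (- (2 * pi * x)) = of_real r / z x"
      using r by (simp add: z_def flip: cis_inverse) (simp add: field_simps)
    hence "cis (- (2 * pi * x)) ^ n = of_real r ^ n / z x ^ n"
      by (simp add: power_divide)
    thus ?thesis using z_nz[of x] by (simp add: field_simps)
  qed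
  ultimately show ?thesis by (simp add: D_def z_def)
qed

text \<open>
  On the circle of radius \<open>r\<close> the function \<open>Re (1 + 2 T)\<close> is a probability density. Since
  \<open>2 Re T = T + cnj T\<close> and \<open>cnj T\<close> has no Fourier coefficients of nonnegative index, its moments
  are \<open>r\<^sup>n t\<^sub>n\<close>. So the moment inequality applies for every \<open>r < 1\<close>, and \<open>r \<rightarrow> 1\<close> gives the claim.
  Setting \<open>t 0 = 1\<close> makes \<open>t\<close> a full moment sequence; the choice \<open>k = 0\<close>, \<open>l = 0\<close> then
  yields Caratheodory's bound \<open>\<bar>t\<^sub>m\<bar> \<le> 1\<close>.
\<close>

lemma caratheodory_coeff_diff_le_one:
  fixes T :: "complex \<Rightarrow> complex" and t :: "nat \<Rightarrow> complex" and l :: real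
  assumes hol: "T holomorphic_on ball 0 1" and T0: "T 0 = 0"
    and Re_nonneg: "\<And>z. z \<in> ball 0 1 \<Longrightarrow> Re (1 + 2 * T z) \<ge> 0"
    and t: "\<And>n. t n = (if n = 0 then 1 else (deriv ^^ n) T 0 / fact n)"
    and l: "0 \<le> l" "l \<le> 2"
  shows "norm (t (k + m) - of_real l * t k * t m) \<le> 1"
proof -
  have bound: "r ^ (k + m) * norm (t (k + m) - of_real l * t k * t m) \<le> 1" if r: "0 < r" "r < 1" for r
  proof -
    define z where "z = (\<lambda>x::real. of_real r * cis (2 * pi * x))"
    define e where "e = (\<lambda>x::real. cis (- (2 * pi * x)))"
    have cnj_e: "cnj (e x) = cis (2 * pi * x)" for x by (simp add: e_def cis_cnj)
    have "z x \<in> ball 0 1" for x using r by (simp add: z_def norm_mult)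
    note nonneg = Re_nonneg[OF this]
    have const: "((\<lambda>x. e x ^ n) has_integral (if n = 0 then 1 else 0)) {0..1}" for n
      using has_integral_circle_fourier[OF holomorphic_on_const[of 1] r, of n]
      by (cases n) (simp_all add: e_def funpow_Suc_right del: funpow.simps)
    have main: "((\<lambda>x. T (z x) * e x ^ n) has_integral of_real r ^ n * ((deriv ^^ n) T 0 / fact n)) {0..1}" for n
      using has_integral_circle_fourier[OF hol r, of n] by (simp add: z_def e_def)
    have T_pow: "((\<lambda>x. T (z x) * z x ^ n) has_integral 0) {0..1}" for n
      using has_integral_circle_fourier[OF holomorphic_on_mult[OF hol holomorphic_on_power[OF holomorphic_on_ident, of n]] r, of 0] T0
      by (simp add: z_def)
    have "((\<lambda>x. T (z x) * cis (2 * pi * x) ^ n) has_integral 0) {0..1}" for n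
    proof -
      have "inverse (of_real r ^ n) * (T (z x) * z x ^ n) = T (z x) * cis (2 * pi * x) ^ n" for x
        using r by (simp add: z_def power_mult_distrib)
      thus ?thesis
        using has_integral_mult_right[OF T_pow[of n], of "inverse (of_real r ^ n)"]
        by (simp only: mult_zero_right)
    qed
    hence "(cnj \<circ> (\<lambda>x. T (z x) * cis (2 * pi * x) ^ n) has_integral cnj 0) {0..1}" for n
      by (simp only: has_integral_cnj)
    hence conj: "((\<lambda>x. cnj (T (z x)) * e x ^ n) has_integral 0) {0..1}" for n
      by (simp add: o_def flip: cnj_e)

    define s where "s = (\<lambda>n. of_real r ^ n * t n)"
    have "norm (s (k + m) - of_real l * s k * s m) \<le> 1"
    proof (rule norm_moment_diff_le_one[where u = "\<lambda>x. Re (1 + 2 * T (z x))"])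
      fix n
      have "((\<lambda>x. e x ^ n + T (z x) * e x ^ n + cnj (T (z x)) * e x ^ n) has_integral
          (if n = 0 then 1 else 0) + of_real r ^ n * ((deriv ^^ n) T 0 / fact n) + 0) {0..1}"
        by (intro has_integral_add const main conj)
      also have "(\<lambda>x. e x ^ n + T (z x) * e x ^ n + cnj (T (z x)) * e x ^ n)
          = (\<lambda>x. of_real (Re (1 + 2 * T (z x))) * cis (- (2 * pi * x)) ^ n)"
        by (intro ext) (simp add: e_def complex_eq_iff algebra_simps)
      also have "(if n = 0 then 1 else 0) + of_real r ^ n * ((deriv ^^ n) T 0 / fact n) + 0 = s n"
        by (simp add: s_def t T0)
      finally show "((\<lambda>x. of_real (Re (1 + 2 * T (z x))) * cis (- (2 * pi * x)) ^ n)
          has_integral s n) {0..1}" .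
    qed (use nonneg l in \<open>auto simp: s_def t\<close>)
    also have "s (k + m) - of_real l * s k * s m
        = of_real (r ^ (k + m)) * (t (k + m) - of_real l * t k * t m)"
      by (simp add: s_def power_add algebra_simps)
    finally show ?thesis using r by (simp add: norm_mult norm_power)
  qed
  have "((\<lambda>r::real. r ^ (k + m) * norm (t (k + m) - of_real l * t k * t m)) \<longlongrightarrow>
      1 ^ (k + m) * norm (t (k + m) - of_real l * t k * t m)) (at_left 1)"
    by (intro tendsto_intros)
  moreover have "eventually (\<lambda>r::real. r ^ (k + m) * norm (t (k + m) - of_real l * t k * t m) \<le> 1) (at_left 1)"
    using eventually_at_left_real[of 0 1] bound by (auto elim!: eventually_mono)
  ultimately have "1 ^ (k + m) * norm (t (k + m) - of_real l * t k * t m) \<le> 1"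
    by (rule tendsto_upperbound) simp
  thus ?thesis by simp
qed

section \<open>Polynomial estimates\<close>

lemma norm_add_scaled_le:
  fixes p q :: complex
  assumes "norm p \<le> A" "norm q \<le> 1" "0 \<le> c"
  shows "norm (p + of_real c * q) \<le> A + c" "norm (p - of_real c * q) \<le> A + c"
proof -
  have "norm (of_real c * q) \<le> c"
    using assms by (simp add: norm_mult mult_left_le)
  thus "norm (p + of_real c * q) \<le> A + c" "norm (p - of_real c * q) \<le> A + c"
    using assms(1) norm_triangle_ineq[of p "of_real c * q"] norm_triangle_ineq4[of p "of_real c * q"]
    by linarith+
qed

lemma norm_mult_le_one:
  fixes p q :: complex
  assumes "norm p \<le> 1" "norm q \<le> 1"
  shows "norm (p * q) \<le> 1"
  using assms by (simp add: norm_mult mult_le_one)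

text \<open>
  Each monomial is absorbed into a multiple of some \<open>t\<^sub>k\<^sub>+\<^sub>m - l t\<^sub>k t\<^sub>m\<close> with \<open>0 \<le> l \<le> 2\<close>, times
  powers of the \<open>t\<^sub>j\<close>. Such a product is bounded by the modulus of its scalar factor, so the grouping
  decides how much of the sum of the moduli of the coefficients is saved.
\<close>

lemma livingston_polynomial_bounds:
  fixes t :: "nat \<Rightarrow> complex"
  assumes D: "\<And>k m l. 0 \<le> l \<Longrightarrow> l \<le> 2 \<Longrightarrow> norm (t (k + m) - of_real l * t k * t m) \<le> 1"
  shows "norm (t 5 / 5 + t 1 * t 4 / 20 - t 2 * t 3 / 30 - t 1 ^ 2 * t 3 / 15 - t 1 * t 2 ^ 2 / 15
           + 11 * t 1 ^ 3 * t 2 / 180 - 17 * t 1 ^ 5 / 1800) \<le> 587 / 1800" (is "norm ?a6 \<le> _")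
    and "norm (t 6 / 6 + t 1 * t 5 / 30 - t 2 * t 4 / 24 - t 3 ^ 2 / 36 - 13 * t 1 ^ 2 * t 4 / 240
           - 37 * t 1 * t 2 * t 3 / 360 - t 2 ^ 3 / 72 + 121 * t 1 ^ 3 * t 3 / 2160
           + 67 * t 1 ^ 2 * t 2 ^ 2 / 720 - 221 * t 1 ^ 4 * t 2 / 4320
           + 881 * t 1 ^ 6 / 129600) \<le> 1397 / 4320" (is "norm ?a7 \<le> _")
proof -
  have t: "norm (t n) \<le> 1" for n using D[of 0 n 0] by simp
  have t_power: "norm (t n ^ k) \<le> 1" for n k by (simp add: norm_power power_le_one t)
  define d where "d = (\<lambda>l k m. t (k + m) - of_real l * t k * t m)"
  have d: "norm (d l k m) \<le> 1" if "0 \<le> l" "l \<le> 2" for l k m using D that by (simp add: d_def)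
  note bound_intros = norm_add_scaled_le norm_mult_le_one t t_power d

  \<comment> \<open>A positive \<open>t 5\<close> absorbs \<open>t 2 * t 3\<close>, then \<open>t 1 * t 4\<close> absorbs \<open>t 1 * t 2 ^ 2\<close>, and
    \<open>t 1 ^ 2 * t 3\<close> absorbs \<open>t 1 ^ 3 * t 2\<close>; the weights add up to the bound exactly.\<close>
  have "norm (0 + of_real (1/5) * d (1/6) 2 3 + of_real (1/20) * (t 1 * d (4/3) 2 2)
      - of_real (1/15) * (t 1 ^ 2 * d (11/12) 1 2) - of_real (17/1800) * t 1 ^ 5)
      \<le> 0 + 1/5 + 1/20 + 1/15 + 17/1800"
    by (intro bound_intros) simp_all
  also have "0 + of_real (1/5) * d (1/6) 2 3 + of_real (1/20) * (t 1 * d (4/3) 2 2)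
      - of_real (1/15) * (t 1 ^ 2 * d (11/12) 1 2) - of_real (17/1800) * t 1 ^ 5 = ?a6"
    by (simp add: d_def field_simps power2_eq_square power3_eq_cube)
  finally show "norm ?a6 \<le> 587 / 1800" by simp

  \<comment> \<open>The weights add up to 166121/518400. The share of \<open>t 6\<close>, split evenly, can absorb more of
    \<open>t 3 ^ 2\<close> and \<open>t 2 * t 4\<close> than is present; the surplus comes back with positive sign and absorbs
    \<open>t 2 ^ 3\<close> and a part of \<open>t 1 * t 2 * t 3\<close>, each at half its price by taking \<open>l = 2\<close>. The
    remaining weights are forced from the highest power of \<open>t 1\<close> down: 881/259200 cancels
    \<open>t 1 ^ 6\<close>, 12379/518400 then cancels \<open>t 1 ^ 4 * t 2\<close>, 121/4320 cancels \<open>t 1 ^ 3 * t 3\<close>, 7/1728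
    what is left of \<open>t 1 * t 2 * t 3\<close>, and \<open>l = 35861/28080\<close> what is left of \<open>t 1 ^ 2 * t 2 ^ 2\<close>.\<close>
  have "norm (0 + of_real (1/12) * d (55/144) 3 3 + of_real (1/12) * d (7/12) 2 4
      + of_real (1/144) * (t 2 * d 2 2 2) + of_real (7/1728) * (t 3 * d 2 1 2)
      + of_real (1/30) * (t 1 * d 2 2 3) - of_real (13/240) * (t 1 ^ 2 * d (35861/28080) 2 2)
      - of_real (121/4320) * (t 1 * t 3 * d 2 1 1) + of_real (12379/518400) * (t 1 ^ 2 * t 2 * d 2 1 1)
      - of_real (881/259200) * (t 1 ^ 4 * d 2 1 1))
      \<le> 0 + 1/12 + 1/12 + 1/144 + 7/1728 + 1/30 + 13/240 + 121/4320 + 12379/518400 + 881/259200"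
    by (intro bound_intros) simp_all
  also have "0 + of_real (1/12) * d (55/144) 3 3 + of_real (1/12) * d (7/12) 2 4
      + of_real (1/144) * (t 2 * d 2 2 2) + of_real (7/1728) * (t 3 * d 2 1 2)
      + of_real (1/30) * (t 1 * d 2 2 3) - of_real (13/240) * (t 1 ^ 2 * d (35861/28080) 2 2)
      - of_real (121/4320) * (t 1 * t 3 * d 2 1 1) + of_real (12379/518400) * (t 1 ^ 2 * t 2 * d 2 1 1)
      - of_real (881/259200) * (t 1 ^ 4 * d 2 1 1) = ?a7"
    by (simp add: d_def numeral_2_eq_2 [symmetric] field_simps power_numeral_reduce)
  finally show "norm ?a7 \<le> 1397 / 4320" by simp
qed

section \<open>The coefficient recursions\<close>

text \<open>
  The three recursions are the coefficient forms of \<open>w (1 + T) = T\<close>, of \<open>z p' = z w' p\<close>, which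
  characterizes \<open>p = exp w\<close>, and of \<open>z f' = f p\<close>. Each determines its sequence step by step, so
  the coefficients of \<open>f\<close> are polynomials in those of \<open>T\<close>.
\<close>

lemma starlike_exp_recursion_solution:
  fixes t c b a :: "nat \<Rightarrow> complex"
  assumes c: "\<And>n. n \<ge> 1 \<Longrightarrow> c n = t n - (\<Sum>k=1..<n. c k * t (n - k))"
    and b: "\<And>n. of_nat n * b n = (\<Sum>k=1..n. of_nat k * c k * b (n - k))" and b0: "b 0 = 1"
    and a: "\<And>n. (of_nat n - 1) * a n = (\<Sum>k=1..<n. a k * b (n - k))" and a1: "a 1 = 1"
  shows
    "a 6 = t 5 / 5 + t 1 * t 4 / 20 - t 2 * t 3 / 30 - t 1 ^ 2 * t 3 / 15
      - t 1 * t 2 ^ 2 / 15 + 11 * t 1 ^ 3 * t 2 / 180 - 17 * t 1 ^ 5 / 1800" (is "_ = ?a6")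
    and "a 7 = t 6 / 6 + t 1 * t 5 / 30 - t 2 * t 4 / 24 - t 3 ^ 2 / 36
      - 13 * t 1 ^ 2 * t 4 / 240 - 37 * t 1 * t 2 * t 3 / 360 - t 2 ^ 3 / 72
      + 121 * t 1 ^ 3 * t 3 / 2160 + 67 * t 1 ^ 2 * t 2 ^ 2 / 720
      - 221 * t 1 ^ 4 * t 2 / 4320 + 881 * t 1 ^ 6 / 129600" (is "_ = ?a7")
proof -
  note expand = atLeastLessThan_nat_numeral power_numeral_reduce field_simps
  note upt = atLeastLessThanSuc_atLeastAtMost [symmetric]
  \<comment> \<open>The simplifier turns the index 1 into \<open>Suc 0\<close>, so the values
      at 1 are needed in that form too.\<close>
  note a1' = a1 [unfolded One_nat_def]
  have c1: "c 1 = t 1"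
    using c[of 1] by (simp add: expand)
  note c1' = c1 [unfolded One_nat_def]
  have c2: "c 2 = t 2 - t 1 ^ 2"
    using c[of 2] by (simp add: c1' expand)
  have c3: "c 3 = t 3 - 2 * t 1 * t 2 + t 1 ^ 3"
    using c[of 3] by (simp add: c1' c2 expand)
  have c4: "c 4 = t 4 - 2 * t 1 * t 3 - t 2 ^ 2 + 3 * t 1 ^ 2 * t 2 - t 1 ^ 4"
    using c[of 4] by (simp add: c1' c2 c3 expand)
  have c5: "c 5 = t 5 - 2 * t 1 * t 4 - 2 * t 2 * t 3 + 3 * t 1 ^ 2 * t 3 + 3 * t 1 * t 2 ^ 2
      - 4 * t 1 ^ 3 * t 2 + t 1 ^ 5"
    using c[of 5] by (simp add: c1' c2 c3 c4 expand)
  have c6: "c 6 = t 6 - 2 * t 1 * t 5 - 2 * t 2 * t 4 - t 3 ^ 2 + 3 * t 1 ^ 2 * t 4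
      + 6 * t 1 * t 2 * t 3 + t 2 ^ 3 - 4 * t 1 ^ 3 * t 3 - 6 * t 1 ^ 2 * t 2 ^ 2
      + 5 * t 1 ^ 4 * t 2 - t 1 ^ 6"
    using c[of 6] by (simp add: c1' c2 c3 c4 c5 expand)
  have "of_nat 1 * b 1 = of_nat 1 * t 1"
    unfolding b[of 1] upt
    by (simp add: b0 c1' expand)
  hence b1: "b 1 = t 1"
    unfolding mult_cancel_left by simp
  note b1' = b1 [unfolded One_nat_def]
  have "of_nat 2 * b 2 = of_nat 2 * (t 2 - t 1 ^ 2 / 2)"
    unfolding b[of 2] upt
    by (simp add: b0 b1' c1' c2 expand)
  hence b2: "b 2 = t 2 - t 1 ^ 2 / 2"
    unfolding mult_cancel_left by simp
  have "of_nat 3 * b 3 = of_nat 3 * (t 3 - t 1 * t 2 + t 1 ^ 3 / 6)"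
    unfolding b[of 3] upt
    by (simp add: b0 b1' b2 c1' c2 c3 expand)
  hence b3: "b 3 = t 3 - t 1 * t 2 + t 1 ^ 3 / 6"
    unfolding mult_cancel_left by simp
  have "of_nat 4 * b 4 = of_nat 4 * (t 4 - t 1 * t 3 - t 2 ^ 2 / 2 + t 1 ^ 2 * t 2 / 2
      + t 1 ^ 4 / 24)"
    unfolding b[of 4] upt
    by (simp add: b0 b1' b2 b3 c1' c2 c3 c4 expand)
  hence b4: "b 4 = t 4 - t 1 * t 3 - t 2 ^ 2 / 2 + t 1 ^ 2 * t 2 / 2 + t 1 ^ 4 / 24"
    unfolding mult_cancel_left by simp
  have "of_nat 5 * b 5 = of_nat 5 * (t 5 - t 1 * t 4 - t 2 * t 3 + t 1 ^ 2 * t 3 / 2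
      + t 1 * t 2 ^ 2 / 2 + t 1 ^ 3 * t 2 / 6 - 19 * t 1 ^ 5 / 120)"
    unfolding b[of 5] upt
    by (simp add: b0 b1' b2 b3 b4 c1' c2 c3 c4 c5 expand)
  hence b5: "b 5 = t 5 - t 1 * t 4 - t 2 * t 3 + t 1 ^ 2 * t 3 / 2 + t 1 * t 2 ^ 2 / 2
      + t 1 ^ 3 * t 2 / 6 - 19 * t 1 ^ 5 / 120"
    unfolding mult_cancel_left by simp
  have "of_nat 6 * b 6 = of_nat 6 * (t 6 - t 1 * t 5 - t 2 * t 4 - t 3 ^ 2 / 2
      + t 1 ^ 2 * t 4 / 2 + t 1 * t 2 * t 3 + t 2 ^ 3 / 6 + t 1 ^ 3 * t 3 / 6
      + t 1 ^ 2 * t 2 ^ 2 / 4 - 19 * t 1 ^ 4 * t 2 / 24 + 151 * t 1 ^ 6 / 720)"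
    unfolding b[of 6] upt
    by (simp add: b0 b1' b2 b3 b4 b5 c1' c2 c3 c4 c5 c6 expand)
  hence b6: "b 6 = t 6 - t 1 * t 5 - t 2 * t 4 - t 3 ^ 2 / 2 + t 1 ^ 2 * t 4 / 2
      + t 1 * t 2 * t 3 + t 2 ^ 3 / 6 + t 1 ^ 3 * t 3 / 6 + t 1 ^ 2 * t 2 ^ 2 / 4
      - 19 * t 1 ^ 4 * t 2 / 24 + 151 * t 1 ^ 6 / 720"
    unfolding mult_cancel_left by simp
  have "(of_nat 2 - 1) * a 2 = (of_nat 2 - 1) * t 1"
    unfolding a[of 2]
    by (simp add: a1' b1' expand)
  hence a2: "a 2 = t 1"
    unfolding mult_cancel_left by simp
  have "(of_nat 3 - 1) * a 3 = (of_nat 3 - 1) * (t 2 / 2 + t 1 ^ 2 / 4)"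
    unfolding a[of 3]
    by (simp add: a1' a2 b1' b2 expand)
  hence a3: "a 3 = t 2 / 2 + t 1 ^ 2 / 4"
    unfolding mult_cancel_left by simp
  have "(of_nat 4 - 1) * a 4 = (of_nat 4 - 1) * (t 3 / 3 + t 1 * t 2 / 6 - t 1 ^ 3 / 36)"
    unfolding a[of 4]
    by (simp add: a1' a2 a3 b1' b2 b3 expand)
  hence a4: "a 4 = t 3 / 3 + t 1 * t 2 / 6 - t 1 ^ 3 / 36"
    unfolding mult_cancel_left by simp
  have "(of_nat 5 - 1) * a 5 = (of_nat 5 - 1) * (t 4 / 4 + t 1 * t 3 / 12
      - t 1 ^ 2 * t 2 / 12 + t 1 ^ 4 / 72)"
    unfolding a[of 5]
    by (simp add: a1' a2 a3 a4 b1' b2 b3 b4 expand)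
  hence a5: "a 5 = t 4 / 4 + t 1 * t 3 / 12 - t 1 ^ 2 * t 2 / 12 + t 1 ^ 4 / 72"
    unfolding mult_cancel_left by simp
  have "(of_nat 6 - 1) * a 6 = (of_nat 6 - 1) * ?a6"
    unfolding a[of 6]
    by (simp add: a1' a2 a3 a4 a5 b1' b2 b3 b4 b5 expand)
  hence a6: "a 6 = ?a6"
    unfolding mult_cancel_left by simp
  have "(of_nat 7 - 1) * a 7 = (of_nat 7 - 1) * ?a7"
    unfolding a[of 7]
    by (simp add: a1' a2 a3 a4 a5 a6 b1' b2 b3 b4 b5 b6 expand)
  hence a7: "a 7 = ?a7"
    unfolding mult_cancel_left by simp
  show "a 6 = ?a6" by (fact a6)
  show "a 7 = ?a7" by (fact a7)
qed

text \<open>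
  The expansion leaves \<open>a 0\<close> and \<open>a 1\<close> open, whereas the power series of \<open>f\<close> has 0 and 1 there.
\<close>

lemma normalized_expansion_imp_has_fps_expansion:
  assumes "normalized_expansion f a"
  shows "f has_fps_expansion Abs_fps (a(0 := 0, 1 := 1))"
proof (rule has_fps_expansionI)
  have "(\<lambda>n. (a(0 := 0, 1 := 1)) n * z ^ n) sums f z" if "z \<in> ball 0 1" for z
  proof -
    have "(\<lambda>n. (a(0 := 0, 1 := 1)) (n + 2) * z ^ (n + 2)) sums (f z - z)"
      using assms that by (simp add: normalized_expansion_def)
    thus ?thesis
      by (subst (asm) sums_iff_shift) (simp add: numeral_2_eq_2)
  qed
  thus "\<forall>\<^sub>F z in nhds 0. (\<lambda>n. fps_nth (Abs_fps (a(0 := 0, 1 := 1))) n * z ^ n) sums f z"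
    using eventually_nhds_in_open[of "ball 0 1" "0 :: complex"] by (auto elim!: eventually_mono)
qed

lemma has_fps_expansion_unique_unit_disc:
  assumes "f has_fps_expansion F" "g has_fps_expansion G"
    and "\<And>z. z \<in> ball 0 1 \<Longrightarrow> f z = g z"
  shows "F = (G :: complex fps)"
proof -
  have "eventually (\<lambda>z. f z = g z) (nhds 0)"
    using eventually_nhds_in_open[of "ball 0 1" "0 :: complex"] assms(3)
    by (auto elim!: eventually_mono)
  hence "f has_fps_expansion G"
    using assms(2) has_fps_expansion_cong[of f g] by blast
  thus ?thesis using assms(1) fps_expansion_unique_complex by blast
qed

text \<open>
  The last term is split off because in the equations for \<open>w\<close> and \<open>f\<close> it contains the coefficient
  to be solved for.
\<close>

lemma fps_mult_nth_of_nth_0: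
  fixes F G :: "complex fps"
  assumes "fps_nth F 0 = 0" "n \<ge> 1"
  shows "fps_nth (F * G) n = (\<Sum>k=1..<n. fps_nth F k * fps_nth G (n - k)) + fps_nth F n * fps_nth G 0"
proof -
  have "fps_nth (F * G) n = (\<Sum>k=0..n. fps_nth F k * fps_nth G (n - k))"
    by (simp add: fps_mult_nth)
  also have "{0..n} = insert 0 (insert n {1..<n})" using assms by auto
  finally show ?thesis using assms by simp
qed

section \<open>The coefficient bounds\<close>

lemma Re_cayley_transform:
  fixes w :: complex
  assumes "norm w < 1"
  shows "Re (1 + 2 * (w / (1 - w))) \<ge> 0"
proof -
  have "w \<noteq> 1" using assms by auto
  hence "1 + 2 * (w / (1 - w)) = (1 + w) / (1 - w)"
    by (simp add: field_simps)
  also have "Re \<dots> = (1 - (norm w)\<^sup>2) / (norm (1 - w))\<^sup>2"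
    unfolding Re_divide' cmod_power2 by (simp add: power2_eq_square algebra_simps)
  also have "\<dots> \<ge> 0"
    using assms by (simp add: power_le_one abs_square_le_1)
  finally show ?thesis .
qed

theorem lemma2p6:
  fixes f :: "complex \<Rightarrow> complex" and a :: "nat \<Rightarrow> complex"
  assumes "f \<in> starlike_exp"
    and "normalized_expansion f a"
  shows "norm (a 6) \<le> 587 / 1800 \<and> norm (a 7) \<le> 1397 / 4320"
proof -
  obtain w where w: "schwarz_function w"
    and quotient: "\<And>z. z \<in> ball 0 1 \<Longrightarrow> log_deriv_quotient f z = exp (w z)"
    using assms(1) by (auto simp: starlike_exp_def subordinate_def)
  have w_hol: "w holomorphic_on ball 0 1" and w0: "w 0 = 0"
    using w by (simp_all add: schwarz_function_def)
  have w_lt_1: "norm (w z) < 1" if "z \<in> ball 0 1" for z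
    using w that by (force simp: schwarz_function_def)
  hence w_neq_1: "w z \<noteq> 1" if "z \<in> ball 0 1" for z
    using that by fastforce

  define T where "T = (\<lambda>z. w z / (1 - w z))"
  define p where "p = (\<lambda>z. exp (w z))"
  have T_hol: "T holomorphic_on ball 0 1"
    unfolding T_def using w_neq_1 by (intro holomorphic_intros w_hol) auto
  have p_hol: "p holomorphic_on ball 0 1"
    unfolding p_def by (intro holomorphic_intros w_hol)
  define W where "W = fps_expansion w 0"
  define S where "S = fps_expansion T 0"
  define P where "P = fps_expansion p 0"
  define F where "F = Abs_fps (a(0 := 0, 1 := 1))"
  have w_W: "w has_fps_expansion W" and T_S: "T has_fps_expansion S" and p_P: "p has_fps_expansion P"
    unfolding W_def S_def P_def
    by (auto intro!: has_fps_expansion_fps_expansion[of "ball 0 1"] w_hol T_hol p_hol)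
  have f_F: "f has_fps_expansion F"
    unfolding F_def by (rule normalized_expansion_imp_has_fps_expansion) fact
  have f0: "f 0 = 0"
    using has_fps_expansion_imp_0_eq_fps_nth_0[OF f_F] by (simp add: F_def)

  have eq_T: "W * (1 + S) = S"
  proof (rule has_fps_expansion_unique_unit_disc)
    show "(\<lambda>z. w z * (1 + T z)) has_fps_expansion W * (1 + S)"
      by (intro fps_expansion_intros w_W T_S)
    show "w z * (1 + T z) = T z" if "z \<in> ball 0 1" for z
      using w_neq_1[OF that] by (simp add: T_def field_simps)
  qed (fact T_S)
  have eq_p: "fps_X * fps_deriv P = (fps_X * fps_deriv W) * P"
  proof (rule has_fps_expansion_unique_unit_disc)
    show "(\<lambda>z. z * deriv p z) has_fps_expansion fps_X * fps_deriv P"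
      by (intro fps_expansion_intros p_P)
    show "(\<lambda>z. (z * deriv w z) * p z) has_fps_expansion (fps_X * fps_deriv W) * P"
      by (intro fps_expansion_intros p_P w_W)
    show "z * deriv p z = (z * deriv w z) * p z" if "z \<in> ball 0 1" for z
    proof -
      have "(w has_field_derivative deriv w z) (at z)"
        using holomorphic_derivI[OF w_hol open_ball that] .
      hence "(p has_field_derivative exp (w z) * deriv w z) (at z)"
        unfolding p_def by (auto intro!: derivative_eq_intros)
      thus ?thesis by (simp add: DERIV_imp_deriv p_def)
    qed
  qed
  have eq_f: "fps_X * fps_deriv F = F * P"
  proof (rule has_fps_expansion_unique_unit_disc)
    show "(\<lambda>z. z * deriv f z) has_fps_expansion fps_X * fps_deriv F"
      by (intro fps_expansion_intros f_F)
    show "(\<lambda>z. f z * p z) has_fps_expansion F * P"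
      by (intro fps_expansion_intros f_F p_P)
    show "z * deriv f z = f z * p z" if "z \<in> ball 0 1" for z
    proof (cases "z = 0")
      case False
      hence "z * deriv f z / f z = p z"
        using quotient[OF that] by (simp add: log_deriv_quotient_def p_def)
      moreover have "f z \<noteq> 0"
        using calculation by (auto simp: p_def)
      ultimately show ?thesis by (simp add: field_simps)
    qed (simp add: f0)
  qed

  have W0: "fps_nth W 0 = 0" and S0: "fps_nth S 0 = 0" and P0: "fps_nth P 0 = 1"
    by (simp_all add: W_def S_def P_def fps_expansion_def w0 T_def p_def)
  define t where "t = (\<lambda>n. if n = 0 then 1 else fps_nth S n)"
  have rec_w: "fps_nth W n = t n - (\<Sum>k=1..<n. fps_nth W k * t (n - k))" if "n \<ge> 1" for n
  proof -
    have "fps_nth S n = (\<Sum>k=1..<n. fps_nth W k * fps_nth (1 + S) (n - k)) + fps_nth W n"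
      using fps_mult_nth_of_nth_0[OF W0 that, of "1 + S"] S0 by (simp add: eq_T)
    also have "(\<Sum>k=1..<n. fps_nth W k * fps_nth (1 + S) (n - k)) = (\<Sum>k=1..<n. fps_nth W k * t (n - k))"
      by (intro sum.cong) (auto simp: t_def)
    finally show ?thesis using that by (simp add: t_def)
  qed
  have X_deriv: "fps_nth (fps_X * fps_deriv G) n = of_nat n * fps_nth G n" for G :: "complex fps" and n
    by (cases n) simp_all
  have rec_p: "of_nat n * fps_nth P n = (\<Sum>k=1..n. of_nat k * fps_nth W k * fps_nth P (n - k))" for n
  proof (cases "n = 0")
    case False
    hence "{1..n} = insert n {1..<n}" by auto
    thus ?thesis
      using fps_mult_nth_of_nth_0[of "fps_X * fps_deriv W" n P] False
      by (simp add: X_deriv P0 flip: eq_p)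
  qed simp
  have rec_f: "(of_nat n - 1) * fps_nth F n = (\<Sum>k=1..<n. fps_nth F k * fps_nth P (n - k))" for n
  proof (cases "n = 0")
    case False
    have "fps_nth F 0 = 0" by (simp add: F_def)
    hence "of_nat n * fps_nth F n = (\<Sum>k=1..<n. fps_nth F k * fps_nth P (n - k)) + fps_nth F n"
      using fps_mult_nth_of_nth_0[of F n P] False unfolding eq_f [symmetric] X_deriv by (simp add: P0)
    thus ?thesis by (simp add: algebra_simps)
  qed (simp add: F_def)

  have "norm (t (k + m) - of_real l * t k * t m) \<le> 1" if "0 \<le> l" "l \<le> 2" for k m l
  proof (rule caratheodory_coeff_diff_le_one[OF T_hol])
    show "Re (1 + 2 * T z) \<ge> 0" if "z \<in> ball 0 1" for z
      unfolding T_def by (rule Re_cayley_transform) (rule w_lt_1[OF that])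
    show "t n = (if n = 0 then 1 else (deriv ^^ n) T 0 / fact n)" for n
      by (simp add: t_def S_def fps_expansion_def)
  qed (use that in \<open>simp_all add: T_def w0\<close>)
  hence bounds: "norm (fps_nth F 6) \<le> 587 / 1800 \<and> norm (fps_nth F 7) \<le> 1397 / 4320"
    if "fps_nth F 1 = 1"
    using livingston_polynomial_bounds[of t]
      starlike_exp_recursion_solution[of "fps_nth W" t "fps_nth P" "fps_nth F", OF rec_w rec_p P0 rec_f that]
    by simp
  thus ?thesis by (simp add: F_def)
qed

end
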